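(* Let $p,m,n\ge 1$ be integers with $n\le m+1$. Let $D=\{d_1,\dots,d_n\}$ be any subset of $[p]$ of cardinality $n$, and let $R_0,\dots,R_n,C_0,\dots,C_n$ be any subsets of $[p]\setminus D$, each of cardinality $m+1-n$, such that $R_k\cap C_k=\emptyset$ for all $k=0,\dots,n$. Let $\Psi=(\psi_{ij})$ be the symmetric $p\times p$-matrix of indeterminates. Let $x_j=\psi_{d_jd_j}$ for $j=1,\dots,n$ and $f_k=\det(\Psi_{DR_k\times DC_k})$ for $k=0,\dots,n$; each $f_k$ is a multilinear polynomial in $x_1,\dots,x_n$ whose coefficients are polynomials in the $\psi_{ij}$. Then the evaluation of the $n$-th multilinear resultant at $f_0,f_1,\dots,f_n$ is an element of $\mathbb{R}[\psi_{ij},\; i\le j]$. This polynomial lies in the ideal $I_{p,m}$, and it is either zero or homogeneous of degree $$\Bigl(m-\frac{n}{2}+1\Bigr)\cdot (n+1)!\,.$$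
   Context: Notation: $[p]=\{1,\dots,p\}$. $\mathbb{R}[\psi_{ij},\, i\le j]$ is the polynomial ring in the entries of a symmetric $p\times p$-matrix $\Psi=(\psi_{ij})$ of indeterminates ($\psi_{ji}=\psi_{ij}$). $\Psi_{DR_k\times DC_k}$ denotes the $(m+1)\times(m+1)$-submatrix of $\Psi$ with rows indexed by $D\cup R_k$ and columns indexed by $D\cup C_k$ (the indices in $D$ listed first, in some fixed order). Factor analysis ideal: $F_{p,m}=\{\Sigma+\Lambda\Lambda^t\in\mathbb{R}^{p\times p} : \Sigma \text{ diagonal and positive definite},\ \Lambda\in\mathbb{R}^{p\times m}\}$, and $I_{p,m}$ is the ideal of all polynomials in the off-diagonal indeterminates, $f\in\mathbb{R}[\psi_{ij},\, i<j]$, with $f(\Psi)=0$ for all $\Psi\in F_{p,m}$. Multilinear resultant: consider $n+1$ generic multilinear polynomials in $x_1,\dots,x_n$, $$g_j=\sum_{i_1,\dots,i_n\in\{0,1\}} a^{j}_{i_1\cdots i_n}\,x_1^{i_1}\cdots x_n^{i_n},\qquad j=0,1,\dots,n,$$ with $2^n(n+1)$ indeterminate coefficients $a^j_{i_1\cdots i_n}$, and let $\mathbb{R}[\mathbf{a}]$ be the polynomial ring in these coefficients and $\mathbb{R}[\mathbf{a},\mathbf{x}]$ the polynomial ring in the coefficients and $x_1,\dots,x_n$. It is known that the elimination ideal $\langle g_0,\dots,g_n\rangle\cap\mathbb{R}[\mathbf{a}]$ (where $\langle g_0,\dots,g_n\rangle$ is an ideal in $\mathbb{R}[\mathbf{a},\mathbf{x}]$)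 is generated by one irreducible polynomial $\mathcal{R}(\mathbf{a})$, which is homogeneous of degree $n!$ in the coefficients of each $g_j$. This polynomial, unique up to a nonzero scalar, is the $n$-th multilinear resultant. Its evaluation at multilinear polynomials $f_0,\dots,f_n$ is obtained by substituting for $a^j_{i_1\cdots i_n}$ the coefficient of $x_1^{i_1}\cdots x_n^{i_n}$ in $f_j$. *)

theory Defs
  imports
    "HOL-Library.Poly_Mapping"
    "HOL-Algebra.Ring_Divisibility"
    "Jordan_Normal_Form.Determinant"
begin

section \<open>Real multivariate polynomials\<close>

text \<open>Monomials are finitely supported exponent functions; the ring operations on polynomials
  are those of the type class instances for \<^type>\<open>poly_mapping\<close>.\<close>

type_synonym 'v mpoly = "('v \<Rightarrow>\<^sub>0 nat) \<Rightarrow>\<^sub>0 real"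

definition mconst :: "real \<Rightarrow> 'v mpoly" where
  "mconst c = Poly_Mapping.single 0 c"

definition mvar :: "'v \<Rightarrow> 'v mpoly" where
  "mvar v = Poly_Mapping.single (Poly_Mapping.single v 1) 1"

definition indets :: "'v mpoly \<Rightarrow> 'v set" where
  "indets f = (\<Union>t\<in>Poly_Mapping.keys f. Poly_Mapping.keys t)"

text \<open>The polynomial ring in the indeterminates \<open>V\<close>, as a subring of the polynomials over the
  whole type of indeterminates.\<close>

definition poly_ring :: "'v set \<Rightarrow> 'v mpoly ring" where
  "poly_ring V = \<lparr>carrier = {f. indets f \<subseteq> V}, mult = (*), one = 1, zero = 0, add = (+)\<rparr>"

definition mp_subst :: "('v \<Rightarrow> 'w mpoly) \<Rightarrow> 'v mpoly \<Rightarrow> 'w mpoly" where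
  "mp_subst \<sigma> f = (\<Sum>t\<in>Poly_Mapping.keys f. mconst (Poly_Mapping.lookup f t) *
     (\<Prod>v\<in>Poly_Mapping.keys t. \<sigma> v ^ Poly_Mapping.lookup t v))"

definition mp_eval :: "('v \<Rightarrow> real) \<Rightarrow> 'v mpoly \<Rightarrow> real" where
  "mp_eval a f = (\<Sum>t\<in>Poly_Mapping.keys f. Poly_Mapping.lookup f t *
     (\<Prod>v\<in>Poly_Mapping.keys t. a v ^ Poly_Mapping.lookup t v))"

definition homogeneous_in :: "'v set \<Rightarrow> nat \<Rightarrow> 'v mpoly \<Rightarrow> bool" where
  "homogeneous_in V N f \<longleftrightarrow>
     (\<forall>t\<in>Poly_Mapping.keys f. (\<Sum>v\<in>Poly_Mapping.keys t \<inter> V. Poly_Mapping.lookup t v) = N)"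

abbreviation homogeneous :: "nat \<Rightarrow> 'v mpoly \<Rightarrow> bool" where
  "homogeneous \<equiv> homogeneous_in UNIV"

text \<open>For \<open>S \<subseteq> X\<close>, the coefficient of the squarefree monomial \<open>\<Prod>v\<in>S. v\<close> when \<open>f\<close> is read as a
  polynomial in the indeterminates \<open>X\<close> with coefficients in the remaining indeterminates.\<close>

definition squarefree_coeff :: "'v set \<Rightarrow> 'v set \<Rightarrow> 'v mpoly \<Rightarrow> 'v mpoly" where
  "squarefree_coeff X S f =
     (\<Sum>t\<in>{t \<in> Poly_Mapping.keys f. \<forall>v\<in>X. Poly_Mapping.lookup t v = (if v \<in> S then 1 else 0)}.
        Poly_Mapping.single (t - (\<Sum>v\<in>S. Poly_Mapping.single v 1)) (Poly_Mapping.lookup f t))"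


section \<open>The multilinear resultant\<close>

text \<open>An exponent vector \<open>i \<in> {0,1}\<^sup>n\<close> is encoded by its support, a subset of \<open>{1..n}\<close>:
  \<open>Coef j S\<close> is the coefficient of \<open>\<Prod>k\<in>S. x\<^sub>k\<close> in \<open>g\<^sub>j\<close>, and \<open>Unk k\<close> is \<open>x\<^sub>k\<close>.\<close>

datatype rvar = Coef nat "nat set" | Unk nat

definition coef_vars_of :: "nat \<Rightarrow> nat \<Rightarrow> rvar set" where
  "coef_vars_of n j = {Coef j S | S. S \<subseteq> {1..n}}"

definition coef_vars :: "nat \<Rightarrow> rvar set" where
  "coef_vars n = (\<Union>j\<in>{0..n}. coef_vars_of n j)"

definition unk_vars :: "nat \<Rightarrow> rvar set" where
  "unk_vars n = Unk ` {1..n}"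

definition generic_multilinear :: "nat \<Rightarrow> nat \<Rightarrow> rvar mpoly" where
  "generic_multilinear n j = (\<Sum>S\<in>Pow {1..n}. mvar (Coef j S) * (\<Prod>k\<in>S. mvar (Unk k)))"

definition elimination_ideal :: "nat \<Rightarrow> rvar mpoly set" where
  "elimination_ideal n =
     genideal (poly_ring (coef_vars n \<union> unk_vars n)) (generic_multilinear n ` {0..n})
       \<inter> carrier (poly_ring (coef_vars n))"

text \<open>The resultant is determined up to a nonzero scalar, hence a predicate.  The classical
  description of the generator of the elimination ideal is recorded in full: its irreducibility and
  its degree \<open>n!\<close> in the coefficients of each \<open>g\<^sub>j\<close> follow from the first two clauses.\<close>

definition is_multilinear_resultant :: "nat \<Rightarrow> rvar mpoly \<Rightarrow> bool" where
  "is_multilinear_resultant n \<R> \<longleftrightarrow>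
     \<R> \<in> carrier (poly_ring (coef_vars n)) \<and>
     elimination_ideal n = genideal (poly_ring (coef_vars n)) {\<R>} \<and>
     ring_irreducible\<^bsub>poly_ring (coef_vars n)\<^esub> \<R> \<and>
     (\<forall>j\<in>{0..n}. homogeneous_in (coef_vars_of n j) (fact n) \<R>)"

text \<open>Evaluation at the multilinear polynomials whose coefficients are \<open>c j S\<close>. A resultant does
  not involve any \<open>Unk k\<close>, so the value chosen for these is irrelevant.\<close>

definition resultant_eval :: "rvar mpoly \<Rightarrow> (nat \<Rightarrow> nat set \<Rightarrow> 'v mpoly) \<Rightarrow> 'v mpoly" where
  "resultant_eval \<R> c = mp_subst (\<lambda>v. case v of Coef j S \<Rightarrow> c j S | Unk k \<Rightarrow> 0) \<R>"


section \<open>The factor analysis ideal\<close>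

text \<open>The indeterminate \<open>\<psi>\<^sub>i\<^sub>j = \<psi>\<^sub>j\<^sub>i\<close> is named by the ordered pair \<open>(min i j, max i j)\<close>.\<close>

definition Psi :: "nat \<Rightarrow> nat \<Rightarrow> (nat \<times> nat) mpoly" where
  "Psi i j = mvar (min i j, max i j)"

definition psi_vars :: "nat \<Rightarrow> (nat \<times> nat) set" where
  "psi_vars p = {(i, j). 1 \<le> i \<and> i \<le> j \<and> j \<le> p}"

definition offdiag_vars :: "nat \<Rightarrow> (nat \<times> nat) set" where
  "offdiag_vars p = {(i, j). 1 \<le> i \<and> i < j \<and> j \<le> p}"

definition positive_definite :: "real mat \<Rightarrow> bool" where
  "positive_definite A \<longleftrightarrow>
     (\<forall>v\<in>carrier_vec (dim_row A). v \<noteq> 0\<^sub>v (dim_row A) \<longrightarrow> v \<bullet> (A *\<^sub>v v) > 0)"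

definition factor_model :: "nat \<Rightarrow> nat \<Rightarrow> real mat set" where
  "factor_model p m = {\<Sigma> + \<Lambda> * transpose_mat \<Lambda> | \<Sigma> \<Lambda>.
     \<Sigma> \<in> carrier_mat p p \<and> diagonal_mat \<Sigma> \<and> positive_definite \<Sigma> \<and> \<Lambda> \<in> carrier_mat p m}"

text \<open>Matrix entries of \<^type>\<open>mat\<close> are indexed from 0, the indeterminates from 1.\<close>

definition factor_ideal :: "nat \<Rightarrow> nat \<Rightarrow> (nat \<times> nat) mpoly set" where
  "factor_ideal p m = {f \<in> carrier (poly_ring (offdiag_vars p)).
     \<forall>A\<in>factor_model p m. mp_eval (\<lambda>(i, j). A $$ (i - 1, j - 1)) f = 0}"

definition Psi_minor :: "nat list \<Rightarrow> nat list \<Rightarrow> (nat \<times> nat) mpoly" where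
  "Psi_minor rs cs =
     det (mat (length rs) (length cs) (\<lambda>(a, b). Psi (rs ! a) (cs ! b)))"

end

theory Submission
  imports Defs
begin

text \<open>Replacing the diagonal entries \<open>x\<^sub>j\<close> by those of \<open>\<Lambda>\<Lambda>\<^sup>t\<close> gives a common zero of the minors \<open>f\<^sub>k\<close>,
  since \<open>\<Lambda>\<Lambda>\<^sup>t\<close> has rank at most \<open>m\<close>; the resultant, lying in the elimination ideal, vanishes there.

  The coefficient of \<open>x\<^sub>S\<close> in \<open>f\<^sub>k\<close> is homogeneous of degree \<open>m + 1 - |S|\<close>, so the degree claim amounts
  to the resultant being homogeneous of weight \<open>n (n+1)! / 2\<close> when \<open>Coef j S\<close> has weight \<open>|S|\<close>. The
  polynomials that vanish whenever the \<open>g\<^sub>j\<close> have a common zero with positive coordinates form the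
  elimination ideal, so among these the resultant is unique up to scalars in its degree. The
  substitutions \<open>x \<mapsto> x / 2\<close> and \<open>x \<mapsto> 1 / x\<close> preserve such zeros; the first shows that the weight is
  constant, the second that it is symmetric under complementing \<open>S\<close>.\<close>

section \<open>Monomials: evaluation and weighted degree\<close>

abbreviation (input) "lookup \<equiv> Poly_Mapping.lookup"
abbreviation (input) "keys \<equiv> Poly_Mapping.keys"

text \<open>The target is any commutative monoid, so that the same notion covers evaluation at real
  points and substitution of polynomials.\<close>

definition mono_eval :: "('v \<Rightarrow> 'a::comm_monoid_mult) \<Rightarrow> ('v \<Rightarrow>\<^sub>0 nat) \<Rightarrow> 'a" where
  "mono_eval a t = (\<Prod>v\<in>keys t. a v ^ lookup t v)"

lemma mp_eval_mono_eval: "mp_eval a f = (\<Sum>t\<in>keys f. lookup f t * mono_eval a t)"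
  by (simp add: mp_eval_def mono_eval_def)

lemma mp_subst_mono_eval: "mp_subst \<sigma> f = (\<Sum>t\<in>keys f. mconst (lookup f t) * mono_eval \<sigma> t)"
  by (simp add: mp_subst_def mono_eval_def)

lemma mono_eval_superset:
  assumes "finite K" "keys t \<subseteq> K"
  shows "mono_eval a t = (\<Prod>v\<in>K. a v ^ lookup t v)"
  unfolding mono_eval_def
  by (rule prod.mono_neutral_left) (use assms in \<open>auto simp: in_keys_iff\<close>)

lemma mono_eval_0 [simp]: "mono_eval a 0 = 1"
  by (simp add: mono_eval_def)

lemma mono_eval_add: "mono_eval a (s + t) = mono_eval a s * mono_eval a t"
proof -
  let ?K = "keys s \<union> keys t"
  have "keys (s + t) \<subseteq> ?K" by (rule Poly_Mapping.keys_add)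
  then show ?thesis
    by (simp add: mono_eval_superset[of ?K] lookup_add power_add prod.distrib)
qed

lemma mono_eval_cong:
  assumes "\<And>v. v \<in> keys t \<Longrightarrow> a v = b v"
  shows "mono_eval a t = mono_eval b t"
  unfolding mono_eval_def using assms by (intro prod.cong) auto

lemma mono_eval_scale:
  fixes a b :: "'v \<Rightarrow> 'a::comm_monoid_mult"
  shows "mono_eval (\<lambda>v. a v * b v) t = mono_eval a t * mono_eval b t"
  by (simp add: mono_eval_def power_mult_distrib prod.distrib)

text \<open>The weight \<open>w = 1\<close> gives the total degree. Other weights occur below:
  powers of a large base that separate monomials, and \<open>coef_card\<close> for the
  resultant.\<close>

definition wdeg :: "('v \<Rightarrow> nat) \<Rightarrow> ('v \<Rightarrow>\<^sub>0 nat) \<Rightarrow> nat" where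
  "wdeg w t = (\<Sum>v\<in>keys t. lookup t v * w v)"

lemma wdeg_superset:
  assumes "finite K" "keys t \<subseteq> K"
  shows "wdeg w t = (\<Sum>v\<in>K. lookup t v * w v)"
  unfolding wdeg_def
  by (rule sum.mono_neutral_left) (use assms in \<open>auto simp: in_keys_iff\<close>)

lemma wdeg_0 [simp]: "wdeg w 0 = 0"
  by (simp add: wdeg_def)

lemma wdeg_add: "wdeg w (s + t) = wdeg w s + wdeg w t"
proof -
  let ?K = "keys s \<union> keys t"
  have "keys (s + t) \<subseteq> ?K" by (rule Poly_Mapping.keys_add)
  then show ?thesis
    by (simp add: wdeg_superset[of ?K] lookup_add sum.distrib distrib_right)
qed

lemma wdeg_single [simp]: "wdeg w (Poly_Mapping.single v k) = k * w v"
  by (simp add: wdeg_def)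

lemma wdeg_sum: "wdeg w (sum f A) = (\<Sum>x\<in>A. wdeg w (f x))"
  by (induction A rule: infinite_finite_induct) (auto simp: wdeg_add)

lemma homogeneous_iff_wdeg: "homogeneous N f \<longleftrightarrow> (\<forall>t\<in>keys f. wdeg (\<lambda>_. 1) t = N)"
  by (simp add: homogeneous_in_def wdeg_def)

lemma mono_eval_power_wdeg: "mono_eval (\<lambda>v. l ^ w v) t = l ^ wdeg w t"
  by (simp add: mono_eval_def wdeg_def power_sum power_mult[symmetric] mult.commute)

section \<open>Evaluation of polynomials at real points\<close>

lemma mp_eval_superset:
  assumes "finite K" "keys f \<subseteq> K"
  shows "mp_eval a f = (\<Sum>t\<in>K. lookup f t * mono_eval a t)"
  unfolding mp_eval_mono_eval
  by (rule sum.mono_neutral_left) (use assms in \<open>auto simp: in_keys_iff\<close>)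

lemma mp_eval_0 [simp]: "mp_eval a 0 = 0"
  by (simp add: mp_eval_def)

lemma mp_eval_add [simp]: "mp_eval a (f + g) = mp_eval a f + mp_eval a g"
proof -
  let ?K = "keys f \<union> keys g"
  have "keys (f + g) \<subseteq> ?K" by (rule Poly_Mapping.keys_add)
  then show ?thesis
    by (simp add: mp_eval_superset[of ?K] lookup_add sum.distrib distrib_right)
qed

lemma mp_eval_single: "mp_eval a (Poly_Mapping.single t c) = c * mono_eval a t"
  by (simp add: mp_eval_mono_eval)

lemma mp_eval_sum [simp]: "mp_eval a (sum f A) = (\<Sum>x\<in>A. mp_eval a (f x))"
  by (induction A rule: infinite_finite_induct) auto

lemma sum_single_lookup: "(\<Sum>t\<in>keys f. Poly_Mapping.single t (lookup f t)) = f"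
proof (rule poly_mapping_eqI)
  fix k
  have "lookup (\<Sum>t\<in>keys f. Poly_Mapping.single t (lookup f t)) k
      = (\<Sum>t\<in>keys f. if t = k then lookup f t else 0)"
    unfolding lookup_sum by (intro sum.cong refl) (simp add: lookup_single "when_def")
  also have "\<dots> = lookup f k"
    by (simp add: in_keys_iff)
  finally show "lookup (\<Sum>t\<in>keys f. Poly_Mapping.single t (lookup f t)) k = lookup f k" .
qed

lemma mp_eval_mult [simp]: "mp_eval a (f * g) = mp_eval a f * mp_eval a g"
proof -
  \<comment> \<open>Both factors are expanded into their terms, so that the product becomes a double
    sum on which evaluation acts term by term.\<close>
  have "f * g = (\<Sum>s\<in>keys f. \<Sum>t\<in>keys g. Poly_Mapping.single (s + t) (lookup f s * lookup g t))"
    by (subst (1) sum_single_lookup[of f, symmetric], subst (1) sum_single_lookup[of g, symmetric])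
      (simp add: sum_product mult_single)
  then have "mp_eval a (f * g) = (\<Sum>s\<in>keys f. \<Sum>t\<in>keys g.
      (lookup f s * mono_eval a s) * (lookup g t * mono_eval a t))"
    by (simp add: mp_eval_single mono_eval_add ac_simps)
  also have "\<dots> = mp_eval a f * mp_eval a g"
    by (simp only: mp_eval_mono_eval sum_product)
  finally show ?thesis .
qed

lemma mp_eval_mconst [simp]: "mp_eval a (mconst c) = c"
  by (simp add: mconst_def mp_eval_single)

lemma mp_eval_mvar [simp]: "mp_eval a (mvar v) = a v"
  by (simp add: mvar_def mp_eval_single mono_eval_def)

lemma mp_eval_1 [simp]: "mp_eval a 1 = 1"
  using mp_eval_mconst[of a 1] by (simp add: mconst_def)

lemma mp_eval_diff [simp]: "mp_eval a (f - g) = mp_eval a f - mp_eval a g"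
  using mp_eval_add[of a "f - g" g] by (simp del: mp_eval_add)

lemma mp_eval_power [simp]: "mp_eval a (f ^ k) = mp_eval a f ^ k"
  by (induction k) auto

lemma mp_eval_prod [simp]: "mp_eval a (prod f A) = (\<Prod>x\<in>A. mp_eval a (f x))"
  by (induction A rule: infinite_finite_induct) auto

text \<open>Reduces statements about substituted polynomials to statements about values; combined
  with \<open>mp_eqI_pos\<close> it yields identities of polynomials.\<close>

lemma mp_eval_mp_subst: "mp_eval a (mp_subst \<sigma> f) = mp_eval (\<lambda>v. mp_eval a (\<sigma> v)) f"
  by (simp add: mp_subst_def mp_eval_def[of _ f])

lemma mp_eval_cong:
  assumes "\<And>v. v \<in> indets f \<Longrightarrow> a v = b v"
  shows "mp_eval a f = mp_eval b f"
  unfolding mp_eval_mono_eval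
  by (intro sum.cong refl arg_cong2[where f = "(*)"] mono_eval_cong assms) (auto simp: indets_def)

lemma comm_ring_hom_mp_eval: "comm_ring_hom (mp_eval a)"
  by unfold_locales auto

section \<open>Indeterminates occurring in a polynomial\<close>

lemma indets_0 [simp]: "indets 0 = {}" by (simp add: indets_def)
lemma indets_1 [simp]: "indets 1 = {}" by (simp add: indets_def)

lemma indets_add: "indets (f + g) \<subseteq> indets f \<union> indets g"
  using Poly_Mapping.keys_add[of f g] by (fastforce simp: indets_def)

lemma keys_uminus: "keys (- f) = keys (f :: 'a \<Rightarrow>\<^sub>0 'b::ab_group_add)"
  by (auto simp: in_keys_iff)

lemma indets_uminus [simp]: "indets (- f) = indets f"
  by (simp add: indets_def keys_uminus)

lemma indets_mult: "indets (f * g) \<subseteq> indets f \<union> indets g"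
proof
  fix v assume "v \<in> indets (f * g)"
  then obtain t where "t \<in> keys (f * g)" "v \<in> keys t" by (auto simp: indets_def)
  then obtain r s where "t = r + s" "r \<in> keys f" "s \<in> keys g"
    using Poly_Mapping.keys_mult[of f g] by auto
  then show "v \<in> indets f \<union> indets g"
    using \<open>v \<in> keys t\<close> Poly_Mapping.keys_add[of r s] by (auto simp: indets_def)
qed

lemma indets_add_subset: "indets f \<subseteq> V \<Longrightarrow> indets g \<subseteq> V \<Longrightarrow> indets (f + g) \<subseteq> V"
  using indets_add[of f g] by blast

lemma indets_mult_subset: "indets f \<subseteq> V \<Longrightarrow> indets g \<subseteq> V \<Longrightarrow> indets (f * g) \<subseteq> V"
  using indets_mult[of f g] by blast

lemma indets_sum_subset: "(\<And>x. x \<in> A \<Longrightarrow> indets (f x) \<subseteq> V) \<Longrightarrow> indets (sum f A) \<subseteq> V"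
  by (induction A rule: infinite_finite_induct) (simp_all add: indets_add_subset)

lemma indets_prod_subset: "(\<And>x. x \<in> A \<Longrightarrow> indets (f x) \<subseteq> V) \<Longrightarrow> indets (prod f A) \<subseteq> V"
  by (induction A rule: infinite_finite_induct) (simp_all add: indets_mult_subset)

lemma indets_power_subset: "indets f \<subseteq> V \<Longrightarrow> indets (f ^ k) \<subseteq> V"
  by (induction k) (simp_all add: indets_mult_subset)

lemma indets_mconst [simp]: "indets (mconst c) = {}"
  by (simp add: indets_def mconst_def)

lemma indets_mvar [simp]: "indets (mvar v) = {v}"
  by (simp add: indets_def mvar_def)

lemma indets_mono_eval_subset:
  "(\<And>v. v \<in> keys t \<Longrightarrow> indets (\<sigma> v) \<subseteq> V) \<Longrightarrow> indets (mono_eval \<sigma> t) \<subseteq> V"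
  unfolding mono_eval_def by (intro indets_prod_subset indets_power_subset)

lemma indets_mp_subst_subset:
  assumes "\<And>v. v \<in> indets f \<Longrightarrow> indets (\<sigma> v) \<subseteq> V"
  shows "indets (mp_subst \<sigma> f) \<subseteq> V"
  unfolding mp_subst_mono_eval
  by (intro indets_sum_subset indets_mult_subset indets_mono_eval_subset assms)
    (auto simp: indets_def[of f])

section \<open>The polynomial rings as rings with carrier, and their ideals\<close>

lemma carrier_poly_ring [simp]: "carrier (poly_ring V) = {f. indets f \<subseteq> V}"
  and mult_poly_ring [simp]: "mult (poly_ring V) = (*)"
  and add_poly_ring [simp]: "add (poly_ring V) = (+)"
  and zero_poly_ring [simp]: "zero (poly_ring V) = 0"
  and one_poly_ring [simp]: "one (poly_ring V) = 1"
  by (simp_all add: poly_ring_def)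

lemma cring_poly_ring: "cring (poly_ring V)"
proof (rule cringI)
  have "\<exists>y. indets y \<subseteq> V \<and> y + x = 0" if "indets x \<subseteq> V" for x :: "'a mpoly"
    using that by (intro exI[of _ "- x"]) auto
  then show "abelian_group (poly_ring V)"
    by (intro abelian_groupI) (simp_all add: indets_add_subset ac_simps)
  show "comm_monoid (poly_ring V)"
    by (intro comm_monoidI) (simp_all add: indets_mult_subset ac_simps)
qed (simp add: distrib_right)

text \<open>Closure under negation follows from multiplication by the polynomial -1.\<close>

lemma ideal_poly_ringI:
  assumes "I \<subseteq> {f. indets f \<subseteq> V}" "0 \<in> I"
    and "\<And>f g. f \<in> I \<Longrightarrow> g \<in> I \<Longrightarrow> f + g \<in> I"
    and "\<And>f g. f \<in> I \<Longrightarrow> indets g \<subseteq> V \<Longrightarrow> g * f \<in> I"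
  shows "ideal I (poly_ring V)"
proof -
  interpret cring "poly_ring V" by (rule cring_poly_ring)
  have "\<ominus>\<^bsub>poly_ring V\<^esub> f \<in> I" if "f \<in> I" for f
  proof -
    have "- 1 * f \<in> I" by (rule assms(4)[OF that]) simp
    moreover have "\<ominus>\<^bsub>poly_ring V\<^esub> f = - f"
      using assms(1) that by (intro minus_equality) auto
    ultimately show ?thesis by simp
  qed
  then show ?thesis
    using assms by (intro idealI[OF ring_axioms] add.subgroupI) (auto simp: mult.commute a_inv_def)
qed

section \<open>Polynomials are determined by their values at positive points\<close>

lemma digit_expansion_inj:
  fixes s t :: "nat \<Rightarrow> nat"
  assumes "\<And>i. i < k \<Longrightarrow> s i < B" "\<And>i. i < k \<Longrightarrow> t i < B"
    and "(\<Sum>i<k. s i * B ^ i) = (\<Sum>i<k. t i * B ^ i)" and "i < k"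
  shows "s i = t i"
  using assms
proof (induction k arbitrary: s t i)
  case (Suc k)
  have split: "(\<Sum>i<Suc k. u i * B ^ i) = u 0 + B * (\<Sum>i<k. u (Suc i) * B ^ i)" for u :: "nat \<Rightarrow> nat"
    unfolding sum.lessThan_Suc_shift by (simp add: sum_distrib_left mult.left_commute)
  have eq: "s 0 + B * (\<Sum>i<k. s (Suc i) * B ^ i) = t 0 + B * (\<Sum>i<k. t (Suc i) * B ^ i)"
    using Suc.prems(3) by (simp only: split)
  have B: "s 0 < B" "t 0 < B" using Suc.prems(1,2) by auto
  have 0: "s 0 = t 0"
    using arg_cong[OF eq, of "\<lambda>x. x mod B"] B by simp
  with eq B have "(\<Sum>i<k. s (Suc i) * B ^ i) = (\<Sum>i<k. t (Suc i) * B ^ i)" by simp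
  then have "s (Suc j) = t (Suc j)" if "j < k" for j
    by (intro Suc.IH[where s = "\<lambda>i. s (Suc i)" and t = "\<lambda>i. t (Suc i)"] Suc.prems(1,2) that)
      simp_all
  with 0 Suc.prems(4) show ?case by (cases i) auto
qed simp

text \<open>Kronecker's substitution: if the weights are distinct powers of a base exceeding all
  exponents, the weighted degree has the exponents as its digits.\<close>

lemma ex_wdeg_inj_on:
  assumes "finite T"
  shows "\<exists>w. inj_on (wdeg w) (T :: ('v \<Rightarrow>\<^sub>0 nat) set)"
proof -
  let ?V = "\<Union>t\<in>T. keys t"
  have fin: "finite ?V" using assms by auto
  obtain h where h: "bij_betw h {..<card ?V} ?V"
    using ex_bij_betw_nat_finite[OF fin] by (auto simp: atLeast0LessThan)
  \<comment> \<open>One more than the sum of all exponents in \<open>T\<close>, hence larger than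
    each of them. The weight of an indeterminate is then \<open>B\<close> to the power of its
    position in the enumeration \<open>h\<close>.\<close>
  define B where "B = Suc (\<Sum>t\<in>T. \<Sum>v\<in>keys t. lookup t v)"
  define w where "w v = B ^ the_inv_into {..<card ?V} h v" for v
  have lookup_less: "lookup t v < B" if "t \<in> T" for t v
  proof -
    have "lookup t v \<le> (\<Sum>v\<in>keys t. lookup t v)"
      by (cases "v \<in> keys t") (auto intro: member_le_sum simp: in_keys_iff)
    also have "\<dots> \<le> (\<Sum>t\<in>T. \<Sum>v\<in>keys t. lookup t v)"
      using that assms by (intro member_le_sum) auto
    finally show ?thesis by (simp add: B_def)
  qed
  have wdeg: "wdeg w t = (\<Sum>i<card ?V. lookup t (h i) * B ^ i)" if "t \<in> T" for t
  proof -
    have "wdeg w t = (\<Sum>v\<in>?V. lookup t v * w v)"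
      using that fin by (intro wdeg_superset) auto
    also have "\<dots> = (\<Sum>i<card ?V. lookup t (h i) * w (h i))"
      using sum.reindex_bij_betw[OF h, of "\<lambda>v. lookup t v * w v"] by simp
    also have "\<dots> = (\<Sum>i<card ?V. lookup t (h i) * B ^ i)"
      using h by (intro sum.cong refl) (simp add: w_def the_inv_into_f_f bij_betw_def)
    finally show ?thesis .
  qed
  have "s = t" if "s \<in> T" "t \<in> T" "wdeg w s = wdeg w t" for s t
  proof (rule poly_mapping_eqI)
    fix v
    show "lookup s v = lookup t v"
    proof (cases "v \<in> ?V")
      case True
      then obtain i where "i < card ?V" "v = h i"
        using h by (auto simp: bij_betw_def)
      then show ?thesis
        using digit_expansion_inj[of "card ?V" "\<lambda>i. lookup s (h i)" B "\<lambda>i. lookup t (h i)" i]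
          lookup_less wdeg that by simp
    next
      case False
      then show ?thesis using that by (auto simp: in_keys_iff)
    qed
  qed
  then show ?thesis by (auto simp: inj_on_def)
qed

lemma mp_eval_at_powers:
  "mp_eval (\<lambda>v. l ^ w v) f = (\<Sum>t\<in>keys f. lookup f t * l ^ wdeg w t)"
  by (simp add: mp_eval_mono_eval mono_eval_power_wdeg)

text \<open>Along the curve sending \<open>v\<close> to \<open>l ^ w v\<close>, with
  \<open>w\<close> separating the monomials of \<open>f\<close>, the polynomial becomes a nonzero
  univariate polynomial in \<open>l\<close>. It has finitely many roots, so some positive
  \<open>l\<close> is not among them.\<close>

lemma ex_pos_mp_eval_nonzero:
  assumes "f \<noteq> 0"
  shows "\<exists>a. (\<forall>v. a v > 0) \<and> mp_eval a f \<noteq> 0"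
proof -
  obtain w where w: "inj_on (wdeg w) (keys f)"
    using ex_wdeg_inj_on[of "keys f"] by auto
  define P where "P = (\<Sum>t\<in>keys f. Polynomial.monom (lookup f t) (wdeg w t))"
  obtain t where t: "t \<in> keys f" "lookup f t \<noteq> 0"
    using assms by (metis in_keys_iff poly_mapping_eqI lookup_zero)
  \<comment> \<open>Distinct monomials have distinct weights, so only \<open>t\<close> contributes
    to this coefficient.\<close>
  have "coeff P (wdeg w t) = (\<Sum>s\<in>keys f. if s = t then lookup f s else 0)"
    unfolding P_def coeff_sum
    using w t by (intro sum.cong refl) (auto simp: inj_on_def)
  with t have "P \<noteq> 0" by auto
  then have "finite {l. poly P l = 0}" by (rule poly_roots_finite)
  then have "\<not> {0<..} \<subseteq> {l. poly P l = 0}"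
    using finite_subset infinite_Ioi by blast
  then obtain l where "l > 0" "poly P l \<noteq> 0" by auto
  moreover have "poly P l = mp_eval (\<lambda>v. l ^ w v) f"
    by (simp add: P_def poly_sum poly_monom mp_eval_at_powers)
  ultimately show ?thesis by (intro exI[of _ "\<lambda>v. l ^ w v"]) auto
qed

text \<open>The restriction to positive points is what later allows the unknowns to be
  inverted.\<close>

lemma mp_eqI_pos:
  assumes "\<And>a. (\<And>v. a v > 0) \<Longrightarrow> mp_eval a f = mp_eval a g"
  shows "f = g"
  using ex_pos_mp_eval_nonzero[of "f - g"] assms by auto

lemma mp_subst_mvar [simp]: "mp_subst mvar f = f"
  by (rule mp_eqI_pos) (simp add: mp_eval_mp_subst)

section \<open>Homogeneous polynomials\<close>

lemma mp_eval_wdeg_scale: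
  assumes "\<And>t. t \<in> keys f \<Longrightarrow> wdeg w t = K"
  shows "mp_eval (\<lambda>v. l ^ w v * a v) f = l ^ K * mp_eval a f"
proof -
  have "lookup f t * mono_eval (\<lambda>v. l ^ w v * a v) t = l ^ K * (lookup f t * mono_eval a t)"
    if "t \<in> keys f" for t
    using assms[OF that] by (simp add: mono_eval_scale mono_eval_power_wdeg)
  then show ?thesis
    unfolding mp_eval_mono_eval sum_distrib_left by (intro sum.cong refl)
qed

lemma mp_eval_homogeneous:
  assumes "homogeneous N f"
  shows "mp_eval (\<lambda>v. l * a v) f = l ^ N * mp_eval a f"
  using mp_eval_wdeg_scale[of f "\<lambda>_. 1" N l a] assms by (simp add: homogeneous_iff_wdeg)

text \<open>Where \<open>f\<close> does not vanish, comparing the scaling of \<open>f\<close> and of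
  \<open>q * f\<close> shows that \<open>q\<close> is constant along the ray through the point.
  Letting the scale tend to 0 gives the value of \<open>q\<close> at the origin, which is the scalar
  sought.\<close>

lemma homogeneous_multiple_same_degree:
  assumes "homogeneous N f" "homogeneous N (q * f)"
  shows "\<exists>c. q * f = mconst c * f"
proof -
  have "mp_eval a (q * f) = mp_eval a (mconst (mp_eval (\<lambda>_. 0) q) * f)" for a
  proof (cases "mp_eval a f = 0")
    case False
    have const: "mp_eval (\<lambda>v. l * a v) q = mp_eval a q" if "l > 0" for l
      using mp_eval_homogeneous[OF assms(1), of l a] mp_eval_homogeneous[OF assms(2), of l a]
        False that by simp
    have "((\<lambda>l. mp_eval (\<lambda>v. l * a v) q) \<longlongrightarrow> mp_eval (\<lambda>v. 0 * a v) q) (at_right 0)"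
      unfolding mp_eval_def by (intro tendsto_intros)
    moreover have "\<forall>\<^sub>F l in at_right 0. mp_eval (\<lambda>v. l * a v) q = mp_eval a q"
      using eventually_at_right_less[of "0::real"] by eventually_elim (rule const)
    then have "((\<lambda>l. mp_eval (\<lambda>v. l * a v) q) \<longlongrightarrow> mp_eval a q) (at_right 0)"
      by (rule tendsto_eventually)
    ultimately have "mp_eval a q = mp_eval (\<lambda>v. 0 * a v) q"
      by (intro tendsto_unique[of "at_right (0::real)"]) auto
    then show ?thesis by simp
  qed simp
  then show ?thesis by (intro exI[of _ "mp_eval (\<lambda>_. 0) q"] mp_eqI_pos)
qed

lemma homogeneous_0 [simp]: "homogeneous N 0"
  by (simp add: homogeneous_iff_wdeg)

lemma homogeneous_add: "homogeneous N f \<Longrightarrow> homogeneous N g \<Longrightarrow> homogeneous N (f + g)"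
  using Poly_Mapping.keys_add[of f g] by (auto simp: homogeneous_iff_wdeg)

lemma homogeneous_sum: "(\<And>x. x \<in> A \<Longrightarrow> homogeneous N (f x)) \<Longrightarrow> homogeneous N (sum f A)"
  by (induction A rule: infinite_finite_induct) (simp_all add: homogeneous_add)

lemma homogeneous_mult:
  "homogeneous M f \<Longrightarrow> homogeneous N g \<Longrightarrow> homogeneous (M + N) (f * g)"
  using Poly_Mapping.keys_mult[of f g] by (fastforce simp: homogeneous_iff_wdeg wdeg_add)

lemma homogeneous_mconst: "homogeneous 0 (mconst c)"
  by (simp add: homogeneous_iff_wdeg mconst_def)

lemma homogeneous_1: "homogeneous 0 1"
  by (simp add: homogeneous_iff_wdeg)

lemma homogeneous_mvar: "homogeneous 1 (mvar v)"
  by (simp add: homogeneous_iff_wdeg mvar_def)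

lemma homogeneous_power: "homogeneous N f \<Longrightarrow> homogeneous (k * N) (f ^ k)"
  by (induction k) (auto simp: homogeneous_1 intro: homogeneous_mult)

lemma homogeneous_prod:
  "(\<And>x. x \<in> A \<Longrightarrow> homogeneous (N x) (f x)) \<Longrightarrow> homogeneous (sum N A) (prod f A)"
  by (induction A rule: infinite_finite_induct) (auto simp: homogeneous_1 intro: homogeneous_mult)

text \<open>Substitution turns the weight \<open>e\<close> of a monomial into the degree of its
  image. This serves for renaming coefficients, with \<open>e\<close> constantly 1, and for
  inserting the coefficients of the minors.\<close>

lemma homogeneous_mp_subst:
  assumes "\<And>v. v \<in> indets f \<Longrightarrow> homogeneous (e v) (\<sigma> v)"
    and "\<And>t. t \<in> keys f \<Longrightarrow> wdeg e t = K"
  shows "homogeneous K (mp_subst \<sigma> f)"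
  unfolding mp_subst_mono_eval
proof (rule homogeneous_sum)
  fix t assume t: "t \<in> keys f"
  then have "homogeneous (wdeg e t) (mono_eval \<sigma> t)"
    unfolding wdeg_def mono_eval_def using assms(1)
    by (intro homogeneous_prod homogeneous_power) (auto simp: indets_def)
  with assms(2)[OF t] show "homogeneous K (mconst (lookup f t) * mono_eval \<sigma> t)"
    using homogeneous_mult[OF homogeneous_mconst] by fastforce
qed

section \<open>Substitution modulo an ideal\<close>

lemma ideal_poly_ringD:
  assumes "ideal J (poly_ring V)"
  shows "f \<in> J \<Longrightarrow> indets f \<subseteq> V" "0 \<in> J"
    and "f \<in> J \<Longrightarrow> g \<in> J \<Longrightarrow> f + g \<in> J"
    and "f \<in> J \<Longrightarrow> indets g \<subseteq> V \<Longrightarrow> g * f \<in> J"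
proof -
  interpret ideal J "poly_ring V" by fact
  show "f \<in> J \<Longrightarrow> indets f \<subseteq> V" using Icarr by auto
  show "0 \<in> J" using additive_subgroup.zero_closed[OF is_additive_subgroup] by simp
  show "f \<in> J \<Longrightarrow> g \<in> J \<Longrightarrow> f + g \<in> J" using additive_subgroup.a_closed[OF is_additive_subgroup] by simp
  show "f \<in> J \<Longrightarrow> indets g \<subseteq> V \<Longrightarrow> g * f \<in> J" using I_l_closed by simp
qed

text \<open>Congruence modulo \<open>J\<close> is compatible with sums and products, so replacing
  indeterminates by congruent polynomials changes \<open>f\<close> only by an element of
  \<open>J\<close>.\<close>

lemma ideal_diff_mp_subst:
  assumes J: "ideal J (poly_ring V)"
    and V: "\<And>v. v \<in> indets (f :: 'v mpoly) \<Longrightarrow> v \<in> V" "\<And>v. v \<in> indets f \<Longrightarrow> indets (\<tau> v) \<subseteq> V"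
    and diff: "\<And>v. v \<in> indets f \<Longrightarrow> mvar v - \<tau> v \<in> J"
  shows "f - mp_subst \<tau> f \<in> J"
proof -
  note JD = ideal_poly_ringD[OF J]
  have mult: "f * g - f' * g' \<in> J"
    if "f - f' \<in> J" "g - g' \<in> J" "indets f' \<subseteq> V" "indets g \<subseteq> V" for f g f' g'
  proof -
    have "f * g - f' * g' = g * (f - f') + f' * (g - g')" by (simp add: algebra_simps)
    with that JD(3,4) show ?thesis by simp
  qed
  have power: "mvar v ^ k - \<tau> v ^ k \<in> J" if "v \<in> indets f" for v k
    by (induction k) (use that V diff JD(2) in \<open>auto intro!: mult indets_power_subset\<close>)
  have prod: "(\<Prod>v\<in>A. mvar v ^ k v) - (\<Prod>v\<in>A. \<tau> v ^ k v) \<in> J" if "A \<subseteq> indets f" for A k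
    using that
  proof (induction A rule: infinite_finite_induct)
    case (insert x A)
    with V power show ?case
      by (auto intro!: mult indets_prod_subset indets_power_subset)
  qed (use JD(2) in auto)
  have mono: "mono_eval mvar t - mono_eval \<tau> t \<in> J" if "t \<in> keys f" for t
    unfolding mono_eval_def using that by (intro prod) (auto simp: indets_def)
  have sum: "sum h A \<in> J" if "\<And>x. x \<in> A \<Longrightarrow> h x \<in> J" for h :: "('v \<Rightarrow>\<^sub>0 nat) \<Rightarrow> _" and A
    using that by (induction A rule: infinite_finite_induct) (use JD in auto)
  have "f - mp_subst \<tau> f = mp_subst mvar f - mp_subst \<tau> f" by simp
  also have "\<dots> = (\<Sum>t\<in>keys f. mconst (lookup f t) * (mono_eval mvar t - mono_eval \<tau> t))"
    unfolding mp_subst_mono_eval by (simp only: sum_subtractf right_diff_distrib)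
  also have "\<dots> \<in> J"
    by (intro sum JD(4) mono) auto
  finally show ?thesis .
qed

section \<open>The elimination ideal of the generic multilinear polynomials\<close>

lemma mp_eval_generic_multilinear:
  "mp_eval a (generic_multilinear n j) = (\<Sum>S\<in>Pow {1..n}. a (Coef j S) * (\<Prod>k\<in>S. a (Unk k)))"
  by (simp add: generic_multilinear_def)

lemma indets_generic_multilinear:
  assumes "j \<le> n"
  shows "indets (generic_multilinear n j) \<subseteq> coef_vars n \<union> unk_vars n"
  unfolding generic_multilinear_def
  by (intro indets_sum_subset indets_mult_subset indets_prod_subset)
    (use assms in \<open>auto simp: coef_vars_def coef_vars_of_def unk_vars_def\<close>)

text \<open>The polynomials vanishing at a fixed point form an ideal, and the generated ideal is the
  smallest one containing \<open>G\<close>.\<close>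

lemma genideal_vanish:
  assumes "f \<in> genideal (poly_ring V) G" "\<And>g. g \<in> G \<Longrightarrow> indets g \<subseteq> V \<and> mp_eval a g = 0"
  shows "mp_eval a f = 0"
proof -
  let ?I = "{f. indets f \<subseteq> V \<and> mp_eval a f = 0}"
  have "ideal ?I (poly_ring V)"
    by (rule ideal_poly_ringI) (simp_all add: indets_add_subset indets_mult_subset Collect_mono_iff)
  with assms show ?thesis by (auto simp: genideal_def)
qed

lemma elimination_ideal_vanish:
  assumes "f \<in> elimination_ideal n" "\<And>j. j \<le> n \<Longrightarrow> mp_eval a (generic_multilinear n j) = 0"
  shows "mp_eval a f = 0"
proof (rule genideal_vanish)
  show "f \<in> genideal (poly_ring (coef_vars n \<union> unk_vars n)) (generic_multilinear n ` {0..n})"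
    using assms(1) by (simp add: elimination_ideal_def)
next
  fix g assume "g \<in> generic_multilinear n ` {0..n}"
  then obtain j where "j \<le> n" "g = generic_multilinear n j" by auto
  then show "indets g \<subseteq> coef_vars n \<union> unk_vars n \<and> mp_eval a g = 0"
    using assms(2) indets_generic_multilinear by simp
qed

text \<open>The constant coefficient of \<open>g\<^sub>j\<close> is an indeterminate occurring
  linearly with factor 1. Subtracting \<open>g\<^sub>j\<close> from it makes every
  \<open>g\<^sub>j\<close> vanish identically, so \<open>f\<close> turns into a polynomial that is
  zero at all positive points, hence zero. Modulo the \<open>g\<^sub>j\<close> this substitution
  changes nothing, so \<open>f\<close> lies in the ideal they generate.\<close>

lemma elimination_idealI:
  assumes f: "indets f \<subseteq> coef_vars n"
    and vanish: "\<And>a. (\<And>k. a (Unk k) > 0) \<Longrightarrow>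
      (\<And>j. j \<le> n \<Longrightarrow> mp_eval a (generic_multilinear n j) = 0) \<Longrightarrow> mp_eval a f = 0"
  shows "f \<in> elimination_ideal n"
proof -
  let ?V = "coef_vars n \<union> unk_vars n" and ?G = "generic_multilinear n ` {0..n}"
  interpret cring "poly_ring ?V" by (rule cring_poly_ring)
  have G: "?G \<subseteq> carrier (poly_ring ?V)" using indets_generic_multilinear by force
  have J: "ideal (genideal (poly_ring ?V) ?G) (poly_ring ?V)" by (rule genideal_ideal[OF G])
  define \<tau> where "\<tau> v = (case v of
      Coef j S \<Rightarrow> if S = {} then mvar v - generic_multilinear n j else mvar v
    | Unk k \<Rightarrow> mvar v)" for v
  have "mp_subst \<tau> f = 0"
  proof (rule mp_eqI_pos)
    fix a :: "rvar \<Rightarrow> real" assume pos: "\<And>v. a v > 0"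
    let ?b = "\<lambda>v. mp_eval a (\<tau> v)"
    have b: "?b (Coef j S) = (if S = {} then a (Coef j S) - mp_eval a (generic_multilinear n j)
        else a (Coef j S))" "?b (Unk k) = a (Unk k)" for j S k
      by (simp_all add: \<tau>_def)
    \<comment> \<open>Passing from \<open>a\<close> to \<open>?b\<close> lowers the constant
      coefficient by exactly the value of \<open>g\<^sub>j\<close> at \<open>a\<close> and keeps all
      other terms.\<close>
    have "mp_eval ?b (generic_multilinear n j) = 0" for j
    proof -
      have split: "(\<Sum>S\<in>Pow {1..n}. h S) = h {} + (\<Sum>S\<in>Pow {1..n} - {{}}. h S)"
        for h :: "nat set \<Rightarrow> real"
        by (intro sum.remove) auto
      have "(\<Sum>S\<in>Pow {1..n} - {{}}. ?b (Coef j S) * (\<Prod>k\<in>S. ?b (Unk k)))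
          = (\<Sum>S\<in>Pow {1..n} - {{}}. a (Coef j S) * (\<Prod>k\<in>S. a (Unk k)))"
        unfolding b by (intro sum.cong) auto
      moreover have "mp_eval a (generic_multilinear n j)
          = a (Coef j {}) + (\<Sum>S\<in>Pow {1..n} - {{}}. a (Coef j S) * (\<Prod>k\<in>S. a (Unk k)))"
        unfolding mp_eval_generic_multilinear by (subst split) simp
      moreover have "mp_eval ?b (generic_multilinear n j)
          = ?b (Coef j {}) + (\<Sum>S\<in>Pow {1..n} - {{}}. ?b (Coef j S) * (\<Prod>k\<in>S. ?b (Unk k)))"
        unfolding mp_eval_generic_multilinear by (subst split) simp
      ultimately show ?thesis by (simp add: b(1))
    qed
    then have "mp_eval ?b f = 0"
      by (intro vanish) (simp_all add: b(2) pos)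
    then show "mp_eval a (mp_subst \<tau> f) = mp_eval a 0"
      by (simp add: mp_eval_mp_subst)
  qed
  moreover have "f - mp_subst \<tau> f \<in> genideal (poly_ring ?V) ?G"
  proof (rule ideal_diff_mp_subst[OF J])
    fix v assume "v \<in> indets f"
    with f obtain j S where v: "v = Coef j S" "j \<le> n" "S \<subseteq> {1..n}"
      by (auto simp: coef_vars_def coef_vars_of_def)
    have mvar: "indets (mvar v) \<subseteq> ?V" using f \<open>v \<in> indets f\<close> by auto
    show "v \<in> ?V" using mvar by simp
    have gen: "generic_multilinear n j \<in> genideal (poly_ring ?V) ?G"
      using genideal_self[OF G] v by auto
    show "mvar v - \<tau> v \<in> genideal (poly_ring ?V) ?G"
      using gen ideal_poly_ringD(2)[OF J] by (simp add: \<tau>_def v)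
    show "indets (\<tau> v) \<subseteq> ?V"
      using mvar indets_generic_multilinear[OF v(2)]
        indets_add_subset[of "mvar v" ?V "- generic_multilinear n j"]
      by (cases "S = {}") (simp_all add: \<tau>_def v)
  qed
  ultimately show ?thesis using f by (simp add: elimination_ideal_def)
qed

section \<open>Degree, uniqueness and weight of the resultant\<close>

fun coef_card :: "rvar \<Rightarrow> nat" where
  "coef_card (Coef j S) = card S"
| "coef_card (Unk k) = 0"

context
  fixes n :: nat and \<R> :: "rvar mpoly"
  assumes res: "is_multilinear_resultant n \<R>"
begin

lemma resultant_indets: "indets \<R> \<subseteq> coef_vars n"
  using res by (simp add: is_multilinear_resultant_def)

lemma resultant_indetsE:
  assumes "v \<in> indets \<R>"
  obtains j S where "v = Coef j S" "j \<le> n" "S \<subseteq> {1..n}"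
  using assms resultant_indets by (auto simp: coef_vars_def coef_vars_of_def)

lemma resultant_in_elimination_ideal: "\<R> \<in> elimination_ideal n"
  using res by (auto simp: is_multilinear_resultant_def genideal_def)

text \<open>The coefficients split into n + 1 disjoint groups, one for each
  \<open>g\<^sub>j\<close>, and each group contributes degree n!.\<close>

lemma resultant_wdeg:
  assumes "t \<in> keys \<R>"
  shows "wdeg (\<lambda>_. 1) t = fact (n + 1)"
proof -
  have keys: "keys t = (\<Union>j\<in>{0..n}. keys t \<inter> coef_vars_of n j)"
    using resultant_indets assms by (auto simp: indets_def coef_vars_def)
  have "wdeg (\<lambda>_. 1) t = (\<Sum>v\<in>(\<Union>j\<in>{0..n}. keys t \<inter> coef_vars_of n j). lookup t v)"
    by (subst keys[symmetric]) (simp add: wdeg_def)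
  also have "\<dots> = (\<Sum>j\<in>{0..n}. \<Sum>v\<in>keys t \<inter> coef_vars_of n j. lookup t v)"
    by (intro sum.UNION_disjoint) (auto simp: coef_vars_of_def)
  also have "\<dots> = (\<Sum>j\<in>{0..n}. fact n)"
    using res assms
    by (intro sum.cong refl) (auto simp: is_multilinear_resultant_def homogeneous_in_def)
  finally show ?thesis by (simp add: algebra_simps)
qed

lemma resultant_homogeneous: "homogeneous (fact (n + 1)) \<R>"
  using resultant_wdeg by (simp add: homogeneous_iff_wdeg)

text \<open>The vanishing condition puts \<open>f\<close> into the elimination ideal, so
  \<open>f\<close> is a multiple of the resultant; as the degrees agree, the cofactor can be
  replaced by a scalar.\<close>

lemma resultant_unique:
  assumes "indets f \<subseteq> coef_vars n" "homogeneous (fact (n + 1)) f"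
    and "\<And>a. (\<And>k. a (Unk k) > 0) \<Longrightarrow>
      (\<And>j. j \<le> n \<Longrightarrow> mp_eval a (generic_multilinear n j) = 0) \<Longrightarrow> mp_eval a f = 0"
  shows "\<exists>c. f = mconst c * \<R>"
proof -
  interpret cring "poly_ring (coef_vars n)" by (rule cring_poly_ring)
  have "f \<in> cgenideal (poly_ring (coef_vars n)) \<R>"
    using elimination_idealI[OF assms(1,3)] res cgenideal_eq_genideal[of \<R>]
    by (simp add: is_multilinear_resultant_def)
  then obtain q where "f = q * \<R>" by (auto simp: cgenideal_def)
  then show ?thesis
    using homogeneous_multiple_same_degree[OF resultant_homogeneous] assms(2) by metis
qed

text \<open>Only coefficients occur in the resultant: \<open>a\<close> prescribes them, while
  \<open>b\<close> may assign the unknowns freely so as to exhibit a common zero.\<close>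

lemma resultant_vanish:
  assumes "\<And>v. v \<in> indets \<R> \<Longrightarrow> a v = b v"
    and "\<And>j. j \<le> n \<Longrightarrow> mp_eval b (generic_multilinear n j) = 0"
  shows "mp_eval a \<R> = 0"
  using elimination_ideal_vanish[OF resultant_in_elimination_ideal assms(2)]
    mp_eval_cong[of \<R> a b] assms(1) by simp

text \<open>Rescaling all unknowns by 1/2 turns common zeros of the polynomials with coefficients
  \<open>2\<^bsup>|S|\<^esup> a\<^sub>S\<close> into those of the polynomials with coefficients \<open>a\<^sub>S\<close>, so by uniqueness the
  rescaled resultant is a multiple of the original one.\<close>

lemma resultant_coef_card_const: "\<exists>w. \<forall>t\<in>keys \<R>. wdeg coef_card t = w"
proof -
  \<comment> \<open>The effect of replacing each \<open>Coef j S\<close> by 2 to the power |S| times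
    itself, written on the level of terms so that single monomials can be compared with those of the
    resultant.\<close>
  define R2 where "R2 = Poly_Mapping.mapp (\<lambda>t c. 2 ^ wdeg coef_card t * c) \<R>"
  have lookup: "lookup R2 t = 2 ^ wdeg coef_card t * lookup \<R> t" for t
    by (auto simp: R2_def lookup_mapp "when_def" in_keys_iff)
  have keys: "keys R2 = keys \<R>"
    by (auto simp: in_keys_iff lookup)
  have eval: "mp_eval a R2 = mp_eval (\<lambda>v. 2 ^ coef_card v * a v) \<R>" for a
    by (simp add: mp_eval_mono_eval keys lookup mono_eval_scale mono_eval_power_wdeg ac_simps)
  obtain c where c: "R2 = mconst c * \<R>"
  proof (atomize_elim, rule resultant_unique)
    show "indets R2 \<subseteq> coef_vars n" using resultant_indets by (simp add: indets_def keys)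
    show "homogeneous (fact (n + 1)) R2"
      using resultant_homogeneous by (simp only: homogeneous_iff_wdeg keys)
    fix a :: "rvar \<Rightarrow> real"
    assume a: "\<And>j. j \<le> n \<Longrightarrow> mp_eval a (generic_multilinear n j) = 0"
    let ?b = "\<lambda>v. case v of Coef j S \<Rightarrow> 2 ^ card S * a v | Unk k \<Rightarrow> a v / 2"
    show "mp_eval a R2 = 0"
      unfolding eval
    proof (rule resultant_vanish)
      fix v assume "v \<in> indets \<R>"
      then show "2 ^ coef_card v * a v = ?b v" by (rule resultant_indetsE) simp
    next
      fix j assume "j \<le> n"
      have "mp_eval ?b (generic_multilinear n j) = mp_eval a (generic_multilinear n j)"
        unfolding mp_eval_generic_multilinear by (intro sum.cong refl) (simp add: prod_dividef)
      with a \<open>j \<le> n\<close> show "mp_eval ?b (generic_multilinear n j) = 0" by simp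
    qed
  qed
  \<comment> \<open>Comparing the coefficients of \<open>t\<close> in \<open>R2\<close> and in its
    multiple of the resultant pins down the weight of \<open>t\<close>.\<close>
  have "2 ^ wdeg coef_card t = c" if "t \<in> keys \<R>" for t
  proof -
    have "lookup (mconst c * \<R>) t = c * lookup \<R> t"
      by (simp add: mconst_def mult_map_scale_conv_mult[symmetric] Poly_Mapping.map.rep_eq "when_def")
    with lookup[of t] c that show ?thesis by (simp add: in_keys_iff)
  qed
  then have "wdeg coef_card s = wdeg coef_card t" if "s \<in> keys \<R>" "t \<in> keys \<R>" for s t
    using that by (metis one_less_numeral_iff power_inject_exp semiring_norm(76))
  then show ?thesis by (metis (full_types))
qed

text \<open>Inverting all unknowns exchanges the coefficients of \<open>S\<close> and of its complement.\<close>

lemma resultant_wdeg_coef_card: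
  assumes "t \<in> keys \<R>"
  shows "2 * wdeg coef_card t = n * fact (n + 1)"
proof -
  define N :: nat where "N = fact (n + 1)"
  define w where "w = wdeg coef_card t"
  have w: "wdeg coef_card s = w" if "s \<in> keys \<R>" for s
    using resultant_coef_card_const that assms unfolding w_def by metis
  define \<kappa> where "\<kappa> v = (case v of Coef j S \<Rightarrow> Coef j ({1..n} - S) | Unk k \<Rightarrow> Unk k)" for v
  define R' where "R' = mp_subst (\<lambda>v. mvar (\<kappa> v)) \<R>"
  have eval: "mp_eval a R' = mp_eval (\<lambda>v. a (\<kappa> v)) \<R>" for a
    by (simp add: R'_def mp_eval_mp_subst)
  obtain c where c: "R' = mconst c * \<R>"
  proof (atomize_elim, rule resultant_unique)
    show "indets R' \<subseteq> coef_vars n"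
      unfolding R'_def
    proof (rule indets_mp_subst_subset)
      fix v assume "v \<in> indets \<R>"
      then show "indets (mvar (\<kappa> v)) \<subseteq> coef_vars n"
        by (rule resultant_indetsE) (auto simp: \<kappa>_def coef_vars_def coef_vars_of_def)
    qed
    show "homogeneous (fact (n + 1)) R'"
      unfolding R'_def by (rule homogeneous_mp_subst[OF homogeneous_mvar resultant_wdeg])
    fix a :: "rvar \<Rightarrow> real"
    assume pos: "\<And>k. a (Unk k) > 0"
      and a: "\<And>j. j \<le> n \<Longrightarrow> mp_eval a (generic_multilinear n j) = 0"
    let ?b = "\<lambda>v. case v of Coef j S \<Rightarrow> a (\<kappa> v) | Unk k \<Rightarrow> 1 / a v"
    show "mp_eval a R' = 0"
      unfolding eval
    proof (rule resultant_vanish)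
      fix v assume "v \<in> indets \<R>"
      then show "a (\<kappa> v) = ?b v" by (rule resultant_indetsE) simp
    next
      fix j assume "j \<le> n"
      let ?P = "\<lambda>S. \<Prod>k\<in>S. a (Unk k)"
      have compl: "bij_betw (\<lambda>S. {1..n} - S) (Pow {1..n}) (Pow {1..n})"
        by (rule bij_betw_byWitness[of _ "\<lambda>S. {1..n} - S"]) auto
      \<comment> \<open>Multiplying by the product of all unknowns clears the denominators: the
        inverse of the product over \<open>S\<close> becomes the product over the complement of
        \<open>S\<close>.\<close>
      have "?P {1..n} * mp_eval ?b (generic_multilinear n j)
          = (\<Sum>S\<in>Pow {1..n}. a (Coef j ({1..n} - S)) * ?P ({1..n} - S))"
        unfolding mp_eval_generic_multilinear sum_distrib_left
      proof (intro sum.cong refl)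
        fix S assume S: "S \<in> Pow {1..n}"
        have "?P {1..n} = ?P ({1..n} - S) * ?P S"
          using S by (intro prod.subset_diff) auto
        moreover have "?P S \<noteq> 0" using S pos by (auto simp: less_imp_neq[THEN not_sym] prod_zero_iff[OF finite_subset[of S "{1..n}"]])
        ultimately show "?P {1..n} * (?b (Coef j S) * (\<Prod>k\<in>S. ?b (Unk k)))
            = a (Coef j ({1..n} - S)) * ?P ({1..n} - S)"
          by (simp add: \<kappa>_def prod_dividef)
      qed
      also have "\<dots> = mp_eval a (generic_multilinear n j)"
        unfolding mp_eval_generic_multilinear
        using sum.reindex_bij_betw[OF compl, of "\<lambda>S. a (Coef j S) * ?P S"] by simp
      also have "\<dots> = 0" using a \<open>j \<le> n\<close> .
      finally show "mp_eval ?b (generic_multilinear n j) = 0"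
        using pos by (auto simp: less_imp_neq[THEN not_sym])
    qed
  qed
  have "\<R> \<noteq> 0" using assms by auto
  then obtain b where b: "mp_eval b \<R> \<noteq> 0" using ex_pos_mp_eval_nonzero by blast
  \<comment> \<open>Complementing twice is the identity on the coefficients, so \<open>R'\<close>
    takes at \<open>a\<close> the nonzero value of the resultant at \<open>b\<close> and may be
    cancelled below.\<close>
  define a where "a v = b (\<kappa> v)" for v
  have "mp_eval a R' = mp_eval b \<R>"
    unfolding eval a_def
  proof (rule mp_eval_cong)
    fix v assume "v \<in> indets \<R>"
    then show "b (\<kappa> (\<kappa> v)) = b v"
      by (rule resultant_indetsE) (simp add: \<kappa>_def double_diff)
  qed
  with b have nz: "mp_eval a R' \<noteq> 0" by simp
  let ?u = "\<lambda>v. 2 ^ coef_card (\<kappa> v) * a (\<kappa> v)"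
  \<comment> \<open>The coefficients are scaled according to |S| both before and after
    complementing. Each scaling contributes a factor \<open>2 ^ w\<close>; together they multiply
    every coefficient by \<open>2 ^ n\<close>, since |S| and the size of the complement add up to
    \<open>n\<close>.\<close>
  have "mp_eval (\<lambda>v. 2 ^ coef_card v * a v) R' = 2 ^ w * mp_eval a R'"
    using mp_eval_wdeg_scale[of \<R> coef_card w 2 a] w by (simp add: c)
  then have "2 ^ w * (2 ^ w * mp_eval a R') = 2 ^ w * mp_eval ?u \<R>"
    by (simp add: eval)
  also have "\<dots> = mp_eval (\<lambda>v. 2 ^ coef_card v * ?u v) \<R>"
    using mp_eval_wdeg_scale[of \<R> coef_card w 2 ?u] w by simp
  also have "\<dots> = mp_eval (\<lambda>v. 2 ^ n * a (\<kappa> v)) \<R>"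
  proof (rule mp_eval_cong)
    fix v assume "v \<in> indets \<R>"
    then obtain j S where v: "v = Coef j S" "S \<subseteq> {1..n}" by (rule resultant_indetsE)
    then have "coef_card v + coef_card (\<kappa> v) = n"
      using card_mono[of "{1..n}" S] by (simp add: \<kappa>_def card_Diff_subset finite_subset)
    then show "2 ^ coef_card v * ?u v = 2 ^ n * a (\<kappa> v)"
      by (metis mult.assoc power_add)
  qed
  also have "\<dots> = 2 ^ (n * N) * mp_eval a R'"
    using mp_eval_homogeneous[OF resultant_homogeneous]
    by (simp add: eval N_def power_mult)
  finally have "(2::real) ^ (2 * w) = 2 ^ (n * N)"
    using nz by (simp add: power_add mult_2)
  then have "2 * w = n * N" by (subst (asm) power_inject_exp) auto
  then show ?thesis by (simp add: w_def N_def)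
qed

end

section \<open>Coefficients with respect to squarefree monomials\<close>

lemma prod_mvar: "(\<Prod>x\<in>A. mvar (g x)) = Poly_Mapping.single (\<Sum>x\<in>A. Poly_Mapping.single (g x) 1) 1"
  by (induction A rule: infinite_finite_induct) (simp_all add: mvar_def mult_single)

lemma lookup_sum_single:
  assumes "finite A"
  shows "lookup (\<Sum>x\<in>A. Poly_Mapping.single (g x) (1::nat)) v = card {x \<in> A. g x = v}"
  using assms
proof (induction A rule: finite_induct)
  case (insert x A)
  have "{y \<in> insert x A. g y = v} = (if g x = v then insert x {y \<in> A. g y = v} else {y \<in> A. g y = v})"
    by auto
  with insert show ?case by (simp add: lookup_add lookup_single "when_def")
qed simp

lemma lookup_indicator:
  "finite T \<Longrightarrow> lookup (\<Sum>v\<in>T. Poly_Mapping.single v (1::nat)) v = (if v \<in> T then 1 else 0)"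
  using lookup_sum_single[of T id v] by (auto simp: Collect_conv_if)

text \<open>Subtraction of exponents is truncated at 0; it is exact here because all exponents on
  \<open>T\<close> equal 1.\<close>

lemma squarefree_part_add:
  fixes t :: "'v \<Rightarrow>\<^sub>0 nat"
  assumes "finite T" "\<And>v. v \<in> T \<Longrightarrow> lookup t v = 1"
  shows "t - (\<Sum>v\<in>T. Poly_Mapping.single v 1) + (\<Sum>v\<in>T. Poly_Mapping.single v 1) = t"
  using assms by (intro poly_mapping_eqI) (simp add: lookup_add lookup_minus lookup_indicator del: One_nat_def)

lemma keys_squarefree_coeff:
  assumes "s \<in> keys (squarefree_coeff X T f)"
  shows "\<exists>t\<in>keys f. (\<forall>v\<in>X. lookup t v = (if v \<in> T then 1 else 0)) \<and>
    s = t - (\<Sum>v\<in>T. Poly_Mapping.single v 1)"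
  using subsetD[OF keys_sum assms[unfolded squarefree_coeff_def]]
  by (auto split: if_splits)

text \<open>On \<open>X\<close> the exponents are 1 on \<open>T\<close>, where they are cancelled,
  and 0 elsewhere.\<close>

lemma indets_squarefree_coeff:
  assumes "T \<subseteq> X" "finite X"
  shows "indets (squarefree_coeff X T f) \<subseteq> indets f - X"
proof
  fix v assume "v \<in> indets (squarefree_coeff X T f)"
  then obtain s where s_keys: "s \<in> keys (squarefree_coeff X T f)" and v: "v \<in> keys s"
    by (auto simp: indets_def)
  obtain t where t: "t \<in> keys f" "\<And>v. v \<in> X \<Longrightarrow> lookup t v = (if v \<in> T then 1 else 0)"
    and s: "s = t - (\<Sum>v\<in>T. Poly_Mapping.single v 1)"
    using keys_squarefree_coeff[OF s_keys] by blast
  have "finite T" using assms finite_subset by blast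
  then have "lookup s v = lookup t v - (if v \<in> T then 1 else 0)"
    by (simp add: s lookup_minus lookup_indicator del: One_nat_def)
  moreover have "lookup s v \<noteq> 0" using v by (simp add: in_keys_iff)
  ultimately have "v \<notin> X" "v \<in> keys t" using t(2)[of v] by (auto simp: in_keys_iff)
  with t(1) show "v \<in> indets f - X" by (auto simp: indets_def)
qed

text \<open>Each contributing monomial is divisible by the product over \<open>T\<close>, so the
  subtraction \<open>N - card T\<close> is exact whenever the coefficient is nonzero.\<close>

lemma homogeneous_squarefree_coeff:
  assumes "T \<subseteq> X" "finite X" "homogeneous N f"
  shows "homogeneous (N - card T) (squarefree_coeff X T f)"
  unfolding homogeneous_iff_wdeg
proof
  fix s assume s_keys: "s \<in> keys (squarefree_coeff X T f)"
  obtain t where t: "t \<in> keys f" "\<And>v. v \<in> X \<Longrightarrow> lookup t v = (if v \<in> T then 1 else 0)"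
    and s: "s = t - (\<Sum>v\<in>T. Poly_Mapping.single v 1)"
    using keys_squarefree_coeff[OF s_keys] by blast
  have "finite T" using assms finite_subset by blast
  have "s + (\<Sum>v\<in>T. Poly_Mapping.single v 1) = t"
    unfolding s using t(2) assms(1) \<open>finite T\<close> by (intro squarefree_part_add) auto
  moreover have "wdeg (\<lambda>_. 1) (s + (\<Sum>v\<in>T. Poly_Mapping.single v 1)) = wdeg (\<lambda>_. 1) s + card T"
    by (simp add: wdeg_add wdeg_sum)
  ultimately have "wdeg (\<lambda>_. 1) t = wdeg (\<lambda>_. 1) s + card T" by simp
  with t(1) assms(3) show "wdeg (\<lambda>_. 1) s = N - card T"
    by (simp add: homogeneous_iff_wdeg)
qed

text \<open>The terms of \<open>f\<close> are grouped by the set of elements of \<open>X\<close>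
  that they involve; by squarefreeness this set determines all their exponents on
  \<open>X\<close>.\<close>

lemma squarefree_expansion:
  assumes "finite X" and sf: "\<And>t v. t \<in> keys f \<Longrightarrow> v \<in> X \<Longrightarrow> lookup t v \<le> 1"
  shows "f = (\<Sum>T\<in>Pow X. squarefree_coeff X T f * (\<Prod>v\<in>T. mvar v))"
proof -
  have "squarefree_coeff X T f * (\<Prod>v\<in>T. mvar v)
      = (\<Sum>t\<in>{t \<in> keys f. X \<inter> keys t = T}. Poly_Mapping.single t (lookup f t))"
    if T: "T \<in> Pow X" for T
  proof -
    let ?A = "{t \<in> keys f. \<forall>v\<in>X. lookup t v = (if v \<in> T then 1 else 0)}"
    have "?A = {t \<in> keys f. X \<inter> keys t = T}"
    proof -
      have "(\<forall>v\<in>X. lookup t v = (if v \<in> T then 1 else 0)) \<longleftrightarrow> X \<inter> keys t = T" if "t \<in> keys f" for t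
      proof -
        have "lookup t v = (if v \<in> keys t then 1 else 0)" if "v \<in> X" for v
          using sf[OF \<open>t \<in> keys f\<close> that] by (auto simp: in_keys_iff)
        then show ?thesis using T by (auto split: if_splits)
      qed
      then show ?thesis by (intro Collect_cong conj_cong refl)
    qed
    moreover have "finite T" using T assms finite_subset by blast
    then have "squarefree_coeff X T f * (\<Prod>v\<in>T. mvar v) = (\<Sum>t\<in>?A. Poly_Mapping.single t (lookup f t))"
      unfolding squarefree_coeff_def prod_mvar sum_distrib_right
      using T by (intro sum.cong refl) (subst mult_single, subst squarefree_part_add, auto)
    ultimately show ?thesis by simp
  qed
  then have "(\<Sum>T\<in>Pow X. squarefree_coeff X T f * (\<Prod>v\<in>T. mvar v))
      = (\<Sum>T\<in>Pow X. \<Sum>t\<in>{t \<in> keys f. X \<inter> keys t = T}. Poly_Mapping.single t (lookup f t))"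
    by (rule sum.cong[OF refl])
  also have "\<dots> = (\<Sum>t\<in>keys f. Poly_Mapping.single t (lookup f t))"
    using assms(1) by (intro sum.group) auto
  finally show ?thesis by (simp add: sum_single_lookup)
qed

section \<open>Minors of the symmetric matrix of indeterminates\<close>

text \<open>Leibniz expansion. Terms of different permutations may cancel, but no monomial arises
  that does not belong to some permutation.\<close>

lemma keys_Psi_minor:
  assumes "length rs = length cs" "t \<in> keys (Psi_minor rs cs)"
  obtains \<pi> where "\<pi> permutes {0..<length rs}"
    "t = (\<Sum>i\<in>{0..<length rs}.
        Poly_Mapping.single (min (rs ! i) (cs ! \<pi> i), max (rs ! i) (cs ! \<pi> i)) 1)"
proof -
  let ?k = "length rs"
  let ?m = "\<lambda>\<pi>. \<Sum>i\<in>{0..<?k}.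
    Poly_Mapping.single (min (rs ! i) (cs ! \<pi> i), max (rs ! i) (cs ! \<pi> i)) (1::nat)"
  let ?A = "mat ?k ?k (\<lambda>(a, b). Psi (rs ! a) (cs ! b))"
  have "Psi_minor rs cs = (\<Sum>\<pi>\<in>{\<pi>. \<pi> permutes {0..<?k}}. signof \<pi> * (\<Prod>i=0..<?k. ?A $$ (i, \<pi> i)))"
    unfolding Psi_minor_def assms(1)[symmetric] by (rule det_def') simp
  also have "\<dots> = (\<Sum>\<pi>\<in>{\<pi>. \<pi> permutes {0..<?k}}. signof \<pi> * Poly_Mapping.single (?m \<pi>) 1)"
  proof (intro sum.cong refl arg_cong2[where f = "(*)"])
    fix \<pi> assume "\<pi> \<in> {\<pi>. \<pi> permutes {0..<?k}}"
    then have "(\<Prod>i=0..<?k. ?A $$ (i, \<pi> i)) = (\<Prod>i=0..<?k. Psi (rs ! i) (cs ! \<pi> i))"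
      by (intro prod.cong refl) (auto simp: permutes_in_image)
    then show "(\<Prod>i=0..<?k. ?A $$ (i, \<pi> i)) = Poly_Mapping.single (?m \<pi>) 1"
      by (simp only: Psi_def prod_mvar)
  qed
  finally have "t \<in> keys (\<Sum>\<pi>\<in>{\<pi>. \<pi> permutes {0..<?k}}. signof \<pi> * Poly_Mapping.single (?m \<pi>) (1::real))"
    using assms(2) by simp
  then obtain \<pi> where \<pi>: "\<pi> permutes {0..<?k}"
    "t \<in> keys (signof \<pi> * Poly_Mapping.single (?m \<pi>) (1::real))"
    using keys_sum by fastforce
  then have "t = ?m \<pi>" by (auto simp: sign_def keys_uminus split: if_splits)
  with \<pi>(1) that show ?thesis by blast
qed

lemma homogeneous_Psi_minor:
  assumes "length rs = length cs"
  shows "homogeneous (length rs) (Psi_minor rs cs)"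
  unfolding homogeneous_iff_wdeg
  by (auto elim!: keys_Psi_minor[OF assms] simp: wdeg_sum)

lemma indets_Psi_minor:
  assumes "length rs = length cs"
  shows "indets (Psi_minor rs cs) \<subseteq> {(min x y, max x y) | x y. x \<in> set rs \<and> y \<in> set cs}"
proof
  fix v assume "v \<in> indets (Psi_minor rs cs)"
  then obtain t where t: "t \<in> keys (Psi_minor rs cs)" "v \<in> keys t" by (auto simp: indets_def)
  then obtain \<pi> where \<pi>: "\<pi> permutes {0..<length rs}"
    "t = (\<Sum>i\<in>{0..<length rs}.
        Poly_Mapping.single (min (rs ! i) (cs ! \<pi> i), max (rs ! i) (cs ! \<pi> i)) 1)"
    by (elim keys_Psi_minor[OF assms])
  have "lookup t v \<noteq> 0" using t(2) by (simp add: in_keys_iff)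
  then have "{i \<in> {0..<length rs}. (min (rs ! i) (cs ! \<pi> i), max (rs ! i) (cs ! \<pi> i)) = v} \<noteq> {}"
    unfolding \<pi>(2) lookup_sum_single[OF finite_atLeastLessThan] by (metis card.empty)
  then obtain i where i: "i < length rs" "v = (min (rs ! i) (cs ! \<pi> i), max (rs ! i) (cs ! \<pi> i))"
    by auto
  moreover have "\<pi> i < length cs" using permutes_in_image[OF \<pi>(1), of i] i(1) assms by simp
  ultimately show "v \<in> {(min x y, max x y) | x y. x \<in> set rs \<and> y \<in> set cs}"
    using nth_mem[of i rs] nth_mem[of "\<pi> i" cs] by blast
qed

text \<open>In a product of entries from distinct rows, a diagonal indeterminate occurs at most once.\<close>

lemma lookup_diag_Psi_minor:
  assumes "length rs = length cs" "distinct rs" "t \<in> keys (Psi_minor rs cs)"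
  shows "lookup t (x, x) \<le> 1"
proof -
  obtain \<pi> where \<pi>: "\<pi> permutes {0..<length rs}"
    "t = (\<Sum>i\<in>{0..<length rs}.
        Poly_Mapping.single (min (rs ! i) (cs ! \<pi> i), max (rs ! i) (cs ! \<pi> i)) 1)"
    using assms by (elim keys_Psi_minor[OF assms(1)])
  define I where
    "I = {i \<in> {0..<length rs}. (min (rs ! i) (cs ! \<pi> i), max (rs ! i) (cs ! \<pi> i)) = (x, x)}"
  \<comment> \<open>Minimum and maximum coincide only if both indices are \<open>x\<close>, so the
    row is determined.\<close>
  have "i < length rs \<and> rs ! i = x" if "i \<in> I" for i
    using that by (auto simp: I_def min_def max_def split: if_splits)
  then have "i = j" if "i \<in> I" "j \<in> I" for i j
    using that nth_eq_iff_index_eq[OF assms(2)] by metis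
  moreover have "finite I" by (simp add: I_def)
  ultimately have "card I \<le> 1"
    by (auto simp: card_le_Suc0_iff_eq)
  then show ?thesis
    unfolding \<pi>(2) lookup_sum_single[OF finite_atLeastLessThan] I_def .
qed

text \<open>The matrix is a product of two N by m and m by N factors, padded with zeros to square
  matrices. As m < N, the row of index \<open>m\<close> of the second factor is zero, and the
  determinant is multiplicative.\<close>

lemma det_low_rank_eq_0:
  fixes u v :: "nat \<Rightarrow> nat \<Rightarrow> 'a::comm_ring_1"
  assumes "m < N"
  shows "det (mat N N (\<lambda>(i, j). \<Sum>l<m. u i l * v j l)) = 0"
proof -
  define P where "P = mat N N (\<lambda>(i, l). if l < m then u i l else 0)"
  define Q where "Q = mat N N (\<lambda>(l, j). if l < m then v j l else 0)"
  have P: "P \<in> carrier_mat N N" and Q: "Q \<in> carrier_mat N N" by (simp_all add: P_def Q_def)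
  have "(\<Sum>l\<in>{0..<N}. (if l < m then u i l else 0) * (if l < m then v j l else 0))
      = (\<Sum>l<m. u i l * v j l)" for i j
    using assms by (intro sum.mono_neutral_cong_right) auto
  then have "mat N N (\<lambda>(i, j). \<Sum>l<m. u i l * v j l) = P * Q"
    by (intro eq_matI) (auto simp: P_def Q_def scalar_prod_def)
  moreover have "det Q = 0"
    unfolding det_def'[OF Q]
  proof (rule sum.neutral, rule ballI)
    fix \<pi> assume "\<pi> \<in> {\<pi>. \<pi> permutes {0..<N}}"
    then have "\<pi> m < N" using assms permutes_in_image[of \<pi> "{0..<N}" m] by simp
    then have "(\<Prod>i = 0..<N. Q $$ (i, \<pi> i)) = 0"
      using assms by (intro prod_zero bexI[of _ m]) (auto simp: Q_def)
    then show "signof \<pi> * (\<Prod>i = 0..<N. Q $$ (i, \<pi> i)) = 0" by simp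
  qed
  ultimately show ?thesis by (simp add: det_mult[OF P Q])
qed

text \<open>Evaluation is a ring homomorphism and commutes with the determinant. The point consists
  of all entries of a product of the form \<open>\<Lambda> * transpose_mat \<Lambda>\<close>,
  including the diagonal ones.\<close>

lemma mp_eval_Psi_minor_low_rank:
  assumes "length rs = length cs" "m < length rs"
  shows "mp_eval (\<lambda>(i, j). \<Sum>l<m. u i l * u j l) (Psi_minor rs cs) = 0"
proof -
  let ?a = "\<lambda>(i, j). \<Sum>l<m. u i l * u j l"
  interpret comm_ring_hom "mp_eval ?a" by (rule comm_ring_hom_mp_eval)
  have Psi: "mp_eval ?a (Psi i j) = (\<Sum>l<m. u i l * u j l)" for i j
    by (simp add: Psi_def min_def max_def mult.commute)
  have "mp_eval ?a (Psi_minor rs cs)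
      = det (mat (length rs) (length rs) (\<lambda>(i, j). \<Sum>l<m. u (rs ! i) l * u (cs ! j) l))"
    unfolding Psi_minor_def hom_det[symmetric] assms(1)[symmetric]
    by (intro arg_cong[of _ _ det] eq_matI) (simp_all add: Psi)
  also have "\<dots> = 0" by (rule det_low_rank_eq_0[OF assms(2)])
  finally show ?thesis .
qed

section \<open>The resultant evaluated at minors: membership in the factor analysis ideal, and
  degree\<close>

theorem theorem23:
  fixes p m n :: nat
    and D :: "nat set" and d :: "nat \<Rightarrow> nat"
    and R C :: "nat \<Rightarrow> nat set"
    and \<R> :: "rvar mpoly"
  defines "DR \<equiv> \<lambda>k. map d [1..<n+1] @ sorted_list_of_set (R k)"
    and "DC \<equiv> \<lambda>k. map d [1..<n+1] @ sorted_list_of_set (C k)"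
  defines "f \<equiv> \<lambda>k. Psi_minor (DR k) (DC k)"
    and "X \<equiv> (\<lambda>j. (d j, d j)) ` {1..n}"
  defines "cf \<equiv> \<lambda>k S. squarefree_coeff X ((\<lambda>j. (d j, d j)) ` S) (f k)"
  assumes "p \<ge> 1" and "m \<ge> 1" and "n \<ge> 1" and "n \<le> m + 1"
    and "D \<subseteq> {1..p}" and "card D = n" and "bij_betw d {1..n} D"
    and "\<And>k. k \<in> {0..n} \<Longrightarrow> R k \<subseteq> {1..p} - D \<and> card (R k) = m + 1 - n"
    and "\<And>k. k \<in> {0..n} \<Longrightarrow> C k \<subseteq> {1..p} - D \<and> card (C k) = m + 1 - n"
    and "\<And>k. k \<in> {0..n} \<Longrightarrow> R k \<inter> C k = {}"
    and "is_multilinear_resultant n \<R>"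
  shows "(\<forall>k\<in>{0..n}.
            (\<forall>S\<in>Pow {1..n}. cf k S \<in> carrier (poly_ring (psi_vars p - X))) \<and>
            f k = (\<Sum>S\<in>Pow {1..n}. cf k S * (\<Prod>j\<in>S. Psi (d j) (d j)))) \<and>
         resultant_eval \<R> cf \<in> carrier (poly_ring (psi_vars p)) \<and>
         resultant_eval \<R> cf \<in> factor_ideal p m \<and>
         (resultant_eval \<R> cf = 0 \<or>
          (\<exists>N::nat. real N = (real m - real n / 2 + 1) * fact (n + 1) \<and>
             homogeneous N (resultant_eval \<R> cf)))"
proof -
  let ?e = "\<lambda>j. (d j, d j)"
  have finX: "finite X" by (simp add: X_def)
  have inj: "inj_on d {1..n}" and dD: "d ` {1..n} = D"
    using assms(12) by (auto simp: bij_betw_def)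
  have inj_e: "inj_on ?e {1..n}" by (rule inj_onI) (simp add: inj_on_eq_iff[OF inj])
  have R: "R k \<subseteq> {1..p} - D" "card (R k) = m + 1 - n"
    and C: "C k \<subseteq> {1..p} - D" "card (C k) = m + 1 - n" if "k \<le> n" for k
    using assms(13)[of k] assms(14)[of k] that by simp_all
  have fin: "finite (R k)" "finite (C k)" if "k \<le> n" for k
    using finite_subset[OF R(1)[OF that]] finite_subset[OF C(1)[OF that]] by simp_all
  have upt: "set [1..<n+1] = {1..n}" by auto
  have set_map_d: "set (map d [1..<n+1]) = D" by (simp only: set_map upt dD)
  have sets: "set (DR k) = D \<union> R k" "set (DC k) = D \<union> C k" if "k \<le> n" for k
    using fin[OF that] by (simp_all only: DR_def DC_def set_append set_map_d set_sorted_list_of_set)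
  have len: "length (DR k) = m + 1" "length (DC k) = m + 1" if "k \<le> n" for k
    using R(2)[OF that] C(2)[OF that] assms(8,9) by (simp_all add: DR_def DC_def)
  have distinct: "distinct (DR k)" if "k \<le> n" for k
  proof -
    have "distinct (map d [1..<n+1])"
      using inj by (simp only: distinct_map upt distinct_upt)
    moreover have "set (map d [1..<n+1]) \<inter> R k = {}" using R(1)[OF that] set_map_d by blast
    ultimately show ?thesis using fin[OF that] by (simp add: DR_def)
  qed
  have X: "X = {(x, x) | x. x \<in> D}" by (auto simp: X_def dD[symmetric])
  have indets_f: "indets (f k) \<subseteq> offdiag_vars p \<union> X" if k: "k \<le> n" for k
  proof
    fix v assume "v \<in> indets (f k)"
    then have "v \<in> {(min x y, max x y) | x y. x \<in> D \<union> R k \<and> y \<in> D \<union> C k}"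
      using indets_Psi_minor[of "DR k" "DC k"] len[OF k] sets[OF k] by (auto simp: f_def)
    then obtain x y where v: "v = (min x y, max x y)" "x \<in> D \<union> R k" "y \<in> D \<union> C k"
      by blast
    \<comment> \<open>Disjointness of \<open>R k\<close> and \<open>C k\<close> enters here: a
      diagonal entry of the submatrix can only come from \<open>D\<close>.\<close>
    have "x \<in> D" if "x = y" using v(2,3) assms(15)[of k] k that by auto
    moreover have "x \<in> {1..p}" "y \<in> {1..p}" using v(2,3) R(1)[OF k] C(1)[OF k] assms(10) by blast+
    ultimately show "v \<in> offdiag_vars p \<union> X"
      by (cases "x = y") (auto simp: v(1) X offdiag_vars_def min_def max_def)
  qed
  have sub: "?e ` S \<subseteq> X" if "S \<subseteq> {1..n}" for S using that by (auto simp: X_def)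
  \<comment> \<open>Once the elements of \<open>X\<close> are split off, only off-diagonal
    indeterminates remain; hence the evaluated resultant lies in the ring in which the factor
    analysis ideal is defined.\<close>
  have indets_cf: "indets (cf k S) \<subseteq> offdiag_vars p" if "k \<le> n" "S \<subseteq> {1..n}" for k S
    using indets_squarefree_coeff[OF sub[OF that(2)] finX, of "f k"] indets_f[OF that(1)]
    unfolding cf_def by blast
  have offdiag: "offdiag_vars p \<subseteq> psi_vars p - X"
    by (auto simp: offdiag_vars_def psi_vars_def X_def)
  have expansion: "f k = (\<Sum>S\<in>Pow {1..n}. cf k S * (\<Prod>j\<in>S. Psi (d j) (d j)))" if "k \<le> n" for k
  proof -
    have "f k = (\<Sum>T\<in>Pow X. squarefree_coeff X T (f k) * (\<Prod>v\<in>T. mvar v))"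
      using lookup_diag_Psi_minor[of "DR k" "DC k"] len[OF that] distinct[OF that]
      by (intro squarefree_expansion finX) (auto simp: f_def X)
    also have "\<dots> = (\<Sum>S\<in>Pow {1..n}. squarefree_coeff X (?e ` S) (f k) * (\<Prod>v\<in>?e ` S. mvar v))"
      unfolding X_def
      by (rule sum.reindex_bij_betw[OF bij_betw_Pow[OF inj_on_imp_bij_betw[OF inj_e]], symmetric])
    also have "\<dots> = (\<Sum>S\<in>Pow {1..n}. cf k S * (\<Prod>j\<in>S. Psi (d j) (d j)))"
    proof (intro sum.cong refl)
      fix S assume "S \<in> Pow {1..n}"
      then have "inj_on ?e S" using inj_e inj_on_subset by blast
      then show "squarefree_coeff X (?e ` S) (f k) * (\<Prod>v\<in>?e ` S. mvar v)
          = cf k S * (\<Prod>j\<in>S. Psi (d j) (d j))"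
        by (simp add: cf_def prod.reindex Psi_def)
    qed
    finally show ?thesis .
  qed
  let ?\<sigma> = "\<lambda>v. case v of Coef j S \<Rightarrow> cf j S | Unk k \<Rightarrow> 0"
  have indets_res: "indets (resultant_eval \<R> cf) \<subseteq> offdiag_vars p"
    unfolding resultant_eval_def
  proof (rule indets_mp_subst_subset)
    fix v assume "v \<in> indets \<R>"
    then show "indets (?\<sigma> v) \<subseteq> offdiag_vars p"
      by (rule resultant_indetsE[OF assms(16)]) (simp add: indets_cf)
  qed
  have "mp_eval (\<lambda>(i, j). A $$ (i - 1, j - 1)) (resultant_eval \<R> cf) = 0"
    if A_model: "A \<in> factor_model p m" for A
  proof -
    obtain \<Sigma> \<Lambda> where A: "A = \<Sigma> + \<Lambda> * transpose_mat \<Lambda>" "\<Sigma> \<in> carrier_mat p p"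
      "diagonal_mat \<Sigma>" "\<Lambda> \<in> carrier_mat p m"
      using A_model by (auto simp: factor_model_def)
    let ?b = "\<lambda>(i, j). \<Sum>l<m. \<Lambda> $$ (i - 1, l) * \<Lambda> $$ (j - 1, l)"
    \<comment> \<open>The diagonal matrix \<open>\<Sigma>\<close> affects only diagonal entries, so
      it may be dropped from the point of evaluation.\<close>
    have "mp_eval (\<lambda>(i, j). A $$ (i - 1, j - 1)) (resultant_eval \<R> cf) = mp_eval ?b (resultant_eval \<R> cf)"
    proof (rule mp_eval_cong)
      fix v assume "v \<in> indets (resultant_eval \<R> cf)"
      then obtain i j where v: "v = (i, j)" "1 \<le> i" "i < j" "j \<le> p"
        using indets_res by (auto simp: offdiag_vars_def)
      then have "A $$ (i - 1, j - 1) = \<Sigma> $$ (i - 1, j - 1) + (\<Lambda> * transpose_mat \<Lambda>) $$ (i - 1, j - 1)"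
        using A(2,4) unfolding A(1) by simp
      moreover have "\<Sigma> $$ (i - 1, j - 1) = 0"
        using A(2,3) v by (simp add: diagonal_mat_def)
      moreover have "(\<Lambda> * transpose_mat \<Lambda>) $$ (i - 1, j - 1) = ?b (i, j)"
        using A(4) v by (simp add: scalar_prod_def atLeast0LessThan)
      ultimately show "(\<lambda>(i, j). A $$ (i - 1, j - 1)) v = ?b v" by (simp add: v)
    qed
    also have "\<dots> = mp_eval (\<lambda>v. mp_eval ?b (?\<sigma> v)) \<R>"
      by (simp add: resultant_eval_def mp_eval_mp_subst)
    also have "\<dots> = 0"
    proof (rule resultant_vanish[OF assms(16)])
      \<comment> \<open>The unknown of index \<open>k\<close> receives the diagonal entry of
        \<open>\<Lambda> * transpose_mat \<Lambda>\<close> belonging to \<open>d k\<close>. The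
        value of \<open>g\<^sub>j\<close> is then that of the full minor \<open>f j\<close>, of size
        m + 1, at a matrix of rank at most m.\<close>
      let ?c = "\<lambda>v. case v of Coef j S \<Rightarrow> mp_eval ?b (cf j S) | Unk k \<Rightarrow> mp_eval ?b (Psi (d k) (d k))"
      show "mp_eval ?b (?\<sigma> v) = ?c v" if "v \<in> indets \<R>" for v
        using that by (rule resultant_indetsE[OF assms(16)]) simp
      fix j assume "j \<le> n"
      have "mp_eval ?c (generic_multilinear n j)
          = mp_eval ?b (\<Sum>S\<in>Pow {1..n}. cf j S * (\<Prod>k\<in>S. Psi (d k) (d k)))"
        by (simp only: mp_eval_generic_multilinear rvar.case mp_eval_sum mp_eval_mult mp_eval_prod)
      also have "\<dots> = mp_eval ?b (f j)" by (simp only: expansion[OF \<open>j \<le> n\<close>, symmetric])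
      also have "\<dots> = 0"
        unfolding f_def using len[OF \<open>j \<le> n\<close>] by (intro mp_eval_Psi_minor_low_rank) simp_all
      finally show "mp_eval ?c (generic_multilinear n j) = 0" .
    qed
    finally show ?thesis .
  qed
  then have factor: "resultant_eval \<R> cf \<in> factor_ideal p m"
    using indets_res by (simp add: factor_ideal_def)
  have degree: "\<exists>N::nat. real N = (real m - real n / 2 + 1) * fact (n + 1) \<and> homogeneous N (resultant_eval \<R> cf)"
    if nz: "resultant_eval \<R> cf \<noteq> 0"
  proof -
    \<comment> \<open>Any monomial of the resultant serves to read off the degree, since all have
      the same weight.\<close>
    obtain t\<^sub>0 where t\<^sub>0: "t\<^sub>0 \<in> keys \<R>"
      using nz by (fastforce simp: resultant_eval_def mp_subst_def)
    define w where "w = wdeg coef_card t\<^sub>0"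
    \<comment> \<open>The degree of the coefficient of a product of |S| diagonal entries in a minor
      of size m + 1. The subtraction is exact because |S| \<le> n \<le> m + 1.\<close>
    define e where "e v = m + 1 - coef_card v" for v
    have w: "2 * w = n * fact (n + 1)"
      using resultant_wdeg_coef_card[OF assms(16) t\<^sub>0] by (simp add: w_def)
    have card_le: "coef_card v \<le> m + 1" if "v \<in> indets \<R>" for v
      using that
    proof (rule resultant_indetsE[OF assms(16)])
      fix j S assume "v = Coef j S" "S \<subseteq> {1..n}"
      then show ?thesis using card_mono[of "{1..n}" S] assms(9) by simp
    qed
    \<comment> \<open>The weights \<open>e\<close> and \<open>coef_card\<close> add up to m + 1 on
      every coefficient, and each monomial has total degree (n + 1)!.\<close>
    have e_w: "wdeg e t + w = (m + 1) * fact (n + 1)" if t: "t \<in> keys \<R>" for t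
    proof -
      have "wdeg coef_card t = w"
        using resultant_wdeg_coef_card[OF assms(16) t] w by simp
      moreover have "wdeg e t + wdeg coef_card t = (\<Sum>v\<in>keys t. lookup t v * (m + 1))"
        unfolding wdeg_def sum.distrib[symmetric]
      proof (rule sum.cong[OF refl])
        fix v assume "v \<in> keys t"
        with t have "v \<in> indets \<R>" by (auto simp: indets_def)
        then have "e v + coef_card v = m + 1" using card_le by (simp add: e_def)
        then show "lookup t v * e v + lookup t v * coef_card v = lookup t v * (m + 1)"
          by (simp only: distrib_left[symmetric])
      qed
      moreover have "\<dots> = (m + 1) * wdeg (\<lambda>_. 1) t"
        by (simp add: wdeg_def sum_distrib_left mult.commute)
      ultimately show ?thesis using resultant_wdeg[OF assms(16) t] by simp
    qed
    have "homogeneous (wdeg e t\<^sub>0) (resultant_eval \<R> cf)"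
      unfolding resultant_eval_def
    proof (rule homogeneous_mp_subst)
      show "wdeg e t = wdeg e t\<^sub>0" if "t \<in> keys \<R>" for t
        using e_w[OF that] e_w[OF t\<^sub>0] by simp
      fix v assume "v \<in> indets \<R>"
      then show "homogeneous (e v) (?\<sigma> v)"
      proof (rule resultant_indetsE[OF assms(16)])
        fix j S assume v: "v = Coef j S" "j \<le> n" "S \<subseteq> {1..n}"
        have "card (?e ` S) = card S"
          using inj_e v(3) by (intro card_image) (rule inj_on_subset)
        moreover have "homogeneous (m + 1) (f j)"
          using homogeneous_Psi_minor[of "DR j" "DC j"] len[OF v(2)] by (simp add: f_def)
        ultimately show ?thesis
          using homogeneous_squarefree_coeff[OF sub[OF v(3)] finX, of "m + 1" "f j"]
          by (simp add: v cf_def e_def)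
      qed
    qed
    moreover have "real (wdeg e t\<^sub>0) = (real m - real n / 2 + 1) * fact (n + 1)"
    proof -
      define F :: nat where "F = fact (n + 1)"
      have "real (wdeg e t\<^sub>0) + real w = (real m + 1) * real F"
        using arg_cong[OF e_w[OF t\<^sub>0, folded F_def], of real] by (simp add: distrib_right)
      moreover have "2 * real w = real n * real F"
        using arg_cong[OF w[folded F_def], of real] by simp
      ultimately have "real (wdeg e t\<^sub>0) = (real m - real n / 2 + 1) * real F"
        by (simp add: algebra_simps)
      then show ?thesis by (simp only: F_def of_nat_fact)
    qed
    ultimately show ?thesis by blast
  qed
  have "cf k S \<in> carrier (poly_ring (psi_vars p - X))" if "k \<le> n" "S \<subseteq> {1..n}" for k S
    unfolding carrier_poly_ring mem_Collect_eq using indets_cf[OF that] offdiag by (rule order_trans)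
  then have "\<forall>k\<in>{0..n}. (\<forall>S\<in>Pow {1..n}. cf k S \<in> carrier (poly_ring (psi_vars p - X))) \<and>
      f k = (\<Sum>S\<in>Pow {1..n}. cf k S * (\<Prod>j\<in>S. Psi (d j) (d j)))"
    by (intro ballI conjI expansion) simp_all
  moreover have "resultant_eval \<R> cf \<in> carrier (poly_ring (psi_vars p))"
    unfolding carrier_poly_ring mem_Collect_eq using indets_res offdiag by blast
  ultimately show ?thesis using factor disj_imp[THEN iffD2, OF impI, OF degree] by (intro conjI)
qed

end
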